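(* Let $a,b\in\mathbb{Z}$, $a<b$, and suppose $g:[a,b]\to\mathbb{R}$ is decreasing, convex, Lipschitz with constant $\frac12$ on $[a,b]$, and has $g(b)=0$. Suppose further that there exists $t\in[a,b]$ for which $g$ is Lipschitz with constant $\frac13$ on $[t,b]$. Then $$\mathbf{T}\left(g+\tfrac14,a,b\right)\le\int_a^bg(z)\,dz-\frac14\lfloor g(t)\rfloor.$$
   Context: For integers $a<b$ and $g:[a,b]\to\mathbb{R}$, the trapezoidal floor sum of $g$ on $[a,b]$ is $$\mathbf{T}(g,a,b)=\frac12\sum_{m=a}^{b-1}\left(\lfloor g(m)\rfloor+\lfloor g(m+1)\rfloor\right).$$ "Decreasing" is meant in the weak sense (non-increasing). "Lipschitz with constant $c$" on an interval means $|g(z)-g(w)|\le c|z-w|$ for all $z,w$ in that interval. *)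

theory Defs
  imports "HOL-Analysis.Analysis"
begin

text \<open>A real function on an interval $[a,b]$ is given by a total function on the reals of which
  only the values on $[a,b]$ are used; here only those at integers of $[a,b]$ matter.\<close>

definition trap_floor_sum :: "(real \<Rightarrow> real) \<Rightarrow> int \<Rightarrow> int \<Rightarrow> real" where
  "trap_floor_sum g a b =
     1 / 2 * (\<Sum>m = a..<b. real_of_int (\<lfloor>g (real_of_int m)\<rfloor> + \<lfloor>g (real_of_int (m + 1))\<rfloor>))"

end

theory Submission
  imports Defs
begin

text \<open>Cut the graph of \<open>g\<close> into horizontal strips \<open>k \<le> y \<le> k + 1\<close> and let \<open>g w = k + 1/2\<close>.
  The area of the strip under the graph is at least \<open>w - a\<close>: replacing \<open>g\<close> by its supporting line
  at \<open>w\<close> only decreases the area, and for the line the bound follows by symmetry about \<open>w\<close>.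
  The strip contributes to the trapezoidal sum at most \<open>z - a + 1/2\<close> if all points \<open>x\<close> with
  \<open>g x \<ge> k + 3/4\<close> lie to the left of \<open>z\<close>. The Lipschitz bound allows \<open>z = w - 1/2\<close>, and even
  \<open>z = w - 3/4\<close> for the strips below the height \<open>g t\<close>, whose number is \<open>\<lfloor>g t\<rfloor>\<close>.\<close>

text \<open>Clamping gives, for \<open>y >= 0\<close>, the length of the part of
  \<open>[0, y]\<close> lying in the layer \<open>[k, k + 1]\<close>, so
  \<open>strip k (g x)\<close> is a vertical section of one strip under the graph.\<close>

definition strip :: "nat \<Rightarrow> real \<Rightarrow> real" where
  "strip k y = max 0 (min 1 (y - real k))"

lemma sum_strip:
  assumes "0 \<le> y"
  shows "(\<Sum>k<N. strip k y) = min y (real N)"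
  using assms by (induction N) (auto simp: strip_def min_def max_def)

text \<open>Layer-cake form of the floor, the discrete counterpart of \<open>sum_strip\<close>: each
  layer filled completely counts once. The \<open>min\<close> absorbs the truncation at
  \<open>N\<close>, so that the induction needs no bound on \<open>y\<close>.\<close>

lemma sum_of_bool_le_floor:
  fixes y :: real
  assumes "0 \<le> y"
  shows "(\<Sum>k<N. of_bool (real k + 1 \<le> y)) = (min (of_int \<lfloor>y\<rfloor>) (real N) :: real)"
proof (induction N)
  case 0
  then show ?case using assms by simp
next
  case (Suc N)
  have "real N + 1 \<le> y \<longleftrightarrow> int N + 1 \<le> \<lfloor>y\<rfloor>"
    by (simp add: le_floor_iff)
  moreover have "real_of_int \<lfloor>y\<rfloor> \<ge> real N + 1 \<longleftrightarrow> int N + 1 \<le> \<lfloor>y\<rfloor>"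
    by linarith
  moreover have "\<not> int N + 1 \<le> \<lfloor>y\<rfloor> \<Longrightarrow> real_of_int \<lfloor>y\<rfloor> \<le> real N"
    by linarith
  ultimately show ?case using Suc by (auto simp: min_def)
qed

lemma continuous_on_strip:
  assumes "continuous_on S g"
  shows "continuous_on S (\<lambda>x. strip k (g x))"
  unfolding strip_def by (intro continuous_intros assms)

lemma integral_strip_ge:
  fixes g :: "real \<Rightarrow> real"
  assumes conv: "convex_on {a..b} g" and cont: "continuous_on {a..b} g"
    and w: "a < w" "w < b" "g w = real k + 1/2" and gb: "g b \<le> real k"
  shows "w - a \<le> integral {a..b} (\<lambda>x. strip k (g x))"
proof -
  obtain s where line: "\<And>x. x \<in> {a..b} \<Longrightarrow> g x \<ge> g w - s * (x - w)"
  proof -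
    have "w \<in> interior {a..b}" using w by simp
    then show ?thesis
      using convex_le_Inf_differential[OF conv] that
      by (metis (no_types, lifting) diff_minus_eq_add mult_minus_left)
  qed
  \<comment> \<open>At \<open>b\<close> the supporting line lies below \<open>g b\<close>, hence at
    height at most \<open>k\<close>, so it drops by at least 1/2 between \<open>w\<close> and
    \<open>b\<close>. This gives \<open>s > 0\<close> and places \<open>d\<close> inside the
    interval.\<close>
  have sb: "1/2 \<le> s * (b - w)"
    using line[of b] w gb by auto
  with w have s: "s > 0"
    by (metis diff_gt_0_iff_gt half_gt_zero_iff less_le_trans zero_less_mult_pos2 zero_less_one)
  \<comment> \<open>The supporting line has height \<open>k\<close> at \<open>d\<close> and height
    \<open>k + 1\<close> at \<open>w - 1/(2 * s)\<close>; \<open>c\<close> is the latter point,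
    moved to \<open>a\<close> if it falls outside the interval.\<close>
  define d where "d = w + 1/(2 * s)"
  define c where "c = max a (w - 1/(2 * s))"
  have "1/(2 * s) \<le> b - w" using sb s by (simp add: field_simps)
  then have d: "d \<le> b" by (simp add: d_def)
  have r: "1/(2 * s) > 0" using s by simp
  have ac: "a \<le> c" and cw: "c < w" and wd: "w < d"
    using w r by (auto simp: c_def d_def)
  have F: "continuous_on {a..b} (\<lambda>x. strip k (g x))"
    by (rule continuous_on_strip[OF cont])
  have int: "(\<lambda>x. strip k (g x)) integrable_on {u..v}" if "a \<le> u" "v \<le> b" for u v
    by (rule integrable_continuous_real, rule continuous_on_subset[OF F]) (use that in auto)
  have split: "integral {a..b} (\<lambda>x. strip k (g x)) = integral {a..c} (\<lambda>x. strip k (g x))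
      + integral {c..d} (\<lambda>x. strip k (g x)) + integral {d..b} (\<lambda>x. strip k (g x))"
    using Henstock_Kurzweil_Integration.integral_combine[of a c b "\<lambda>x. strip k (g x)"]
      Henstock_Kurzweil_Integration.integral_combine[of c d b "\<lambda>x. strip k (g x)"]
      ac cw wd d w int by force
  have left: "c - a \<le> integral {a..c} (\<lambda>x. strip k (g x))"
  proof (cases "a < w - 1/(2 * s)")
    case True
    then have c: "c = w - 1/(2 * s)" by (simp add: c_def)
    have "integral {a..c} (\<lambda>x. 1::real) \<le> integral {a..c} (\<lambda>x. strip k (g x))"
    proof (rule integral_le)
      fix x assume x: "x \<in> {a..c}"
      then have "s * (x - w) \<le> s * (- (1/(2 * s)))"
        using s c by (intro mult_left_mono) auto
      then have "s * (x - w) \<le> - 1/2" using s by simp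
      then have "g x \<ge> real k + 1" using line[of x] x w cw by auto
      then show "1 \<le> strip k (g x)" by (simp add: strip_def)
    qed (use int cw w in auto)
    then show ?thesis using ac by simp
  next
    case False
    then have "c = a" by (simp add: c_def)
    then show ?thesis by simp
  qed
  have mid: "w - c \<le> integral {c..d} (\<lambda>x. strip k (g x))"
  proof -
    have I: "((\<lambda>x. 1/2 - s * (x - w)) has_integral
       (d/2 - s * (d - w)^2/2) - (c/2 - s * (c - w)^2/2)) {c..d}"
      using cw wd by (intro fundamental_theorem_of_calculus)
        (auto intro!: derivative_eq_intros simp flip: has_real_derivative_iff_has_vector_derivative)
    \<comment> \<open>If \<open>c\<close> is not moved to \<open>a\<close>, the area missing below
      height \<open>k + 1\<close> on the left of \<open>w\<close> equals the area above height
      \<open>k\<close> on the right, and the surplus is zero. Cutting at \<open>a\<close> only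
      discards missing area, a triangle whose area is the square term below.\<close>
    have "w - c \<le> (d/2 - s * (d - w)^2/2) - (c/2 - s * (c - w)^2/2)"
    proof -
      define u where "u = w - c"
      have e: "d = w + 1/(2 * s)" "c = w - u" by (auto simp: d_def u_def)
      have "(d/2 - s * (d - w)^2/2) - (c/2 - s * (c - w)^2/2) - (w - c)
          = s/2 * (1/(2 * s) - u)^2"
        using s unfolding e by (simp add: field_simps power2_eq_square)
      also have "\<dots> \<ge> 0" using s by simp
      finally show ?thesis by simp
    qed
    also have "\<dots> = integral {c..d} (\<lambda>x. 1/2 - s * (x - w))"
      using I by (simp add: integral_unique)
    also have "\<dots> \<le> integral {c..d} (\<lambda>x. strip k (g x))"
    proof (rule integral_le)
      fix x assume x: "x \<in> {c..d}"
      then have "s * (w - x) \<le> s * (1/(2 * s))"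
        using s by (intro mult_left_mono) (auto simp: c_def)
      then have "- 1/2 \<le> s * (x - w)" using s by (simp add: algebra_simps)
      then show "1/2 - s * (x - w) \<le> strip k (g x)"
        using line[of x] x w ac d by (auto simp: strip_def)
    qed (use I int ac d in auto)
    finally show ?thesis .
  qed
  have "0 \<le> integral {d..b} (\<lambda>x. strip k (g x))"
    by (rule integral_nonneg) (use int ac cw wd in \<open>auto simp: strip_def\<close>)
  with left mid split show ?thesis by simp
qed

lemma trapezoid_of_bool_le:
  fixes z :: real and a b :: int
  assumes "of_int a \<le> z" "z < of_int b"
  shows "1/2 * (\<Sum>m = a..<b. of_bool (of_int m \<le> z) + of_bool (of_int (m + 1) \<le> z))
    \<le> z - of_int a + 1/2"
proof -
  \<comment> \<open>Since \<open>z < b\<close>, every integer of \<open>[a, z]\<close> occurs as a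
    left endpoint \<open>m\<close>; all but \<open>a\<close> occur as a right endpoint
    \<open>m + 1\<close>. This asymmetry yields the 1/2.\<close>
  have "{a..<b} \<inter> {m. of_int m \<le> z} = {a..\<lfloor>z\<rfloor>}"
    "{a..<b} \<inter> {m. of_int (m + 1) \<le> z} = {a..<\<lfloor>z\<rfloor>}"
    using assms by (auto simp: le_floor_iff; linarith)+
  then have "(\<Sum>m = a..<b. of_bool (of_int m \<le> z) + of_bool (of_int (m + 1) \<le> z))
      = real (card {a..\<lfloor>z\<rfloor>}) + real (card {a..<\<lfloor>z\<rfloor>})"
    by (simp add: sum.distrib sum_of_bool_eq)
  also have "\<dots> = 2 * (of_int \<lfloor>z\<rfloor> - of_int a) + 1"
    using assms by (simp add: le_floor_iff)
  finally show ?thesis by simp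
qed

text \<open>The correction with the floor of \<open>g t\<close> is shared out among the strips: 1/4
  for each \<open>k\<close> with \<open>k + 1 <= g t\<close>. Summing over \<open>k\<close> then
  gives the theorem.\<close>

lemma strip_bound:
  fixes g :: "real \<Rightarrow> real" and a b :: int and t :: real
  assumes ab: "a < b"
    and mono: "antimono_on {real_of_int a..real_of_int b} g"
    and conv: "convex_on {real_of_int a..real_of_int b} g"
    and lip: "(1/2)-lipschitz_on {real_of_int a..real_of_int b} g"
    and gb: "g (real_of_int b) = 0"
    and t: "t \<in> {real_of_int a..real_of_int b}"
    and lipt: "(1/3)-lipschitz_on {t..real_of_int b} g"
  shows "1/2 * (\<Sum>m = a..<b. of_bool (real k + 1 \<le> g (of_int m) + 1/4)
        + of_bool (real k + 1 \<le> g (of_int (m + 1)) + 1/4)) + 1/4 * of_bool (real k + 1 \<le> g t)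
      \<le> integral {real_of_int a..real_of_int b} (\<lambda>x. strip k (g x))" (is "?T + ?E \<le> ?I")
proof -
  have cont: "continuous_on {real_of_int a..real_of_int b} g"
    by (rule lipschitz_on_continuous_on[OF lip])
  have le: "g y \<le> g x" if "of_int a \<le> x" "x \<le> y" "y \<le> of_int b" for x y
    using mono that by (auto simp: monotone_on_def)
  \<comment> \<open>The threshold is \<open>k + 1\<close> shifted by the 1/4 added to
    \<open>g\<close>. If even \<open>g a\<close> misses it, the whole left-hand side
    vanishes.\<close>
  show ?thesis
  proof (cases "real k + 3/4 \<le> g (of_int a)")
    case False
    have small: "\<not> real k + 1 \<le> g (of_int m) + 1/4" if "a \<le> m" "m \<le> b" for m
      using le[of "of_int a" "of_int m"] that False by auto
    have "?T = 0"
      using small[of m for m] small[of "m + 1" for m] by (simp del: of_int_add)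
    moreover have "?E = 0" using le[of "of_int a" t] t False by auto
    moreover have "0 \<le> ?I"
      by (intro integral_nonneg integrable_continuous_real continuous_on_strip cont)
        (simp add: strip_def)
    ultimately show ?thesis by simp
  next
    case True
    obtain w where w: "of_int a \<le> w" "w \<le> of_int b" "g w = real k + 1/2"
      using IVT2'[of g "of_int b" "real k + 1/2" "of_int a"] True gb cont ab by auto
    have aw: "of_int a < w" and wb: "w < of_int b"
      using True w gb by (auto simp: less_le)
    have I: "w - of_int a \<le> ?I"
      by (rule integral_strip_ge[OF conv cont]) (use w aw wb gb in auto)
    \<comment> \<open>Descending from \<open>k + 3/4\<close> to \<open>k + 1/2\<close> takes a
      distance of at least 1/2 at slope 1/2 and at least 3/4 at slope 1/3. With this
      \<open>z\<close>, the bound \<open>z - a + 1/2\<close> plus the correction is exactly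
      \<open>w - a\<close>.\<close>
    define z where "z = w - 1/2 - ?E"
    have xz: "x \<le> z" if x: "of_int a \<le> x" "x \<le> of_int b" "real k + 3/4 \<le> g x" for x
    proof -
      have xw: "x \<le> w"
        using le[of w x] w x by linarith
      have half: "g x - g w \<le> 1/2 * (w - x)"
        using lipschitz_onD[OF lip, of x w] x w xw by (auto simp: dist_real_def)
      show ?thesis
      proof (cases "real k + 1 \<le> g t")
        case False
        then show ?thesis using half x w by (simp add: z_def)
      next
        case True
        then have tw: "t < w"
          using le[of w t] w t by force
        have third: "g y - g w \<le> 1/3 * (w - y)" if "t \<le> y" "y \<le> w" for y
          using lipschitz_onD[OF lipt, of y w] that w tw unfolding dist_real_def by simp argo
        \<comment> \<open>For \<open>x >= t\<close> the slope bound 1/3 applies directly. For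
          \<open>x < t\<close> it is applied at \<open>t\<close>: the drop from \<open>g t\<close>
          to \<open>g w\<close> is at least 1/2, so \<open>t <= w - 3/2\<close>, which is more than
          enough.\<close>
        show ?thesis
          using third[of x] third[of t] True tw x w xw by (cases "t \<le> x") (auto simp: z_def)
      qed
    qed
    have "?T \<le> 1/2 * (\<Sum>m = a..<b. of_bool (of_int m \<le> z) + of_bool (of_int (m + 1) \<le> z))"
    proof (intro mult_left_mono sum_mono add_mono)
      fix m assume m: "m \<in> {a..<b}"
      show "(of_bool (real k + 1 \<le> g (of_int m) + 1/4) :: real) \<le> of_bool (of_int m \<le> z)"
        using xz[of "of_int m"] m by auto
      have "real_of_int (m + 1) \<le> of_int b"
        using m by (intro of_int_le_iff[THEN iffD2]) auto
      then show "(of_bool (real k + 1 \<le> g (of_int (m + 1)) + 1/4) :: real)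
          \<le> of_bool (of_int (m + 1) \<le> z)"
        using xz[of "of_int (m + 1)"] m by auto
    qed auto
    also have "\<dots> \<le> z - of_int a + 1/2"
      by (rule trapezoid_of_bool_le) (use xz[of "of_int a"] True ab wb in \<open>auto simp: z_def\<close>)
    finally show ?thesis
      using I by (simp add: z_def)
  qed
qed

theorem theorem3p4:
  fixes g :: "real \<Rightarrow> real" and a b :: int and t :: real
  assumes "a < b"
    and "antimono_on {real_of_int a..real_of_int b} g"
    and "convex_on {real_of_int a..real_of_int b} g"
    and "(1/2)-lipschitz_on {real_of_int a..real_of_int b} g"
    and "g (real_of_int b) = 0"
    and "t \<in> {real_of_int a..real_of_int b}"
    and "(1/3)-lipschitz_on {t..real_of_int b} g"
  shows "trap_floor_sum (\<lambda>x. g x + 1/4) a b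
           \<le> integral {real_of_int a..real_of_int b} g - 1/4 * real_of_int \<lfloor>g t\<rfloor>"
proof -
  let ?J = "{real_of_int a..real_of_int b}"
  have cont: "continuous_on ?J g"
    by (rule lipschitz_on_continuous_on[OF assms(4)])
  have le: "g y \<le> g x" if "of_int a \<le> x" "x \<le> y" "y \<le> of_int b" for x y
    using assms(2) that by (auto simp: monotone_on_def)
  \<comment> \<open>By monotonicity this \<open>N\<close> bounds \<open>g + 1/4\<close> on the whole
    interval, so the truncated layer sums are exact.\<close>
  obtain N where N: "g (of_int a) + 1/4 \<le> real N"
    using real_arch_simple by blast
  have g: "0 \<le> g x" "g x + 1/4 \<le> real N" if "x \<in> ?J" for x
    using le[of x "of_int b"] le[of "of_int a" x] that assms(5) N by auto
  let ?s = "\<lambda>x. \<Sum>k<N. of_bool (real k + 1 \<le> g x + 1/4)"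
  have fl: "real_of_int \<lfloor>g x + 1/4\<rfloor> = ?s x" if "x \<in> ?J" for x
    using sum_of_bool_le_floor[of "g x + 1/4" N] g[OF that] by linarith
  have T: "trap_floor_sum (\<lambda>x. g x + 1/4) a b
      = 1/2 * (\<Sum>m = a..<b. ?s (of_int m) + ?s (of_int (m + 1)))"
    unfolding trap_floor_sum_def
  proof (intro arg_cong2[where f = "(*)"] refl sum.cong)
    fix m assume m: "m \<in> {a..<b}"
    then have "real_of_int m \<in> ?J" "real_of_int (m + 1) \<in> ?J"
      unfolding atLeastAtMost_iff of_int_le_iff by auto
    then show "real_of_int (\<lfloor>g (of_int m) + 1/4\<rfloor> + \<lfloor>g (of_int (m + 1)) + 1/4\<rfloor>)
        = ?s (of_int m) + ?s (of_int (m + 1))"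
      by (simp only: of_int_add[of "\<lfloor>_\<rfloor>"] fl)
  qed
  have E: "real_of_int \<lfloor>g t\<rfloor> = (\<Sum>k<N. of_bool (real k + 1 \<le> g t))"
    using sum_of_bool_le_floor[of "g t" N] g[OF assms(6)] by linarith
  \<comment> \<open>Exchanging the sums over nodes and layers isolates the contribution of each
    strip.\<close>
  have "trap_floor_sum (\<lambda>x. g x + 1/4) a b + 1/4 * real_of_int \<lfloor>g t\<rfloor>
      = (\<Sum>k<N. 1/2 * (\<Sum>m = a..<b. of_bool (real k + 1 \<le> g (of_int m) + 1/4)
        + of_bool (real k + 1 \<le> g (of_int (m + 1)) + 1/4)) + 1/4 * of_bool (real k + 1 \<le> g t))"
    unfolding T E sum.distrib[symmetric] sum_distrib_left
    by (subst sum.swap) (simp only: sum.distrib sum_distrib_left)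
  also have "\<dots> \<le> (\<Sum>k<N. integral ?J (\<lambda>x. strip k (g x)))"
    by (intro sum_mono strip_bound assms)
  also have "\<dots> = integral ?J (\<lambda>x. \<Sum>k<N. strip k (g x))"
    by (rule integral_sum[symmetric])
      (auto intro: integrable_continuous_real continuous_on_strip cont)
  also have "\<dots> = integral ?J g"
    by (rule integral_cong) (use sum_strip g in force)
  finally show ?thesis by simp
qed

end
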